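(* Let $n\ge1$. The Voronoi cell $V(\mathbf 0)$ of the lattice $A_n$ is the projection of the unit cube $[0,1]^{n+1}$ via $\Xi$, i.e. $$V(\mathbf 0)=\Xi\,[0,1]^{n+1}.$$
   Context: Let $\mathbf 1=(1,\dots,1)^T\in\mathbb R^{n+1}$ and $H=\{x\in\mathbb R^{n+1}:x\cdot\mathbf 1=0\}$. The lattice $A_n$ is $\mathbb Z^{n+1}\cap H$. Its Voronoi cell at the origin, taken inside $H$, is $V(\mathbf 0)=\{x\in H:\|x\|\le\|x-q\|\text{ for all }q\in A_n\}$. The matrix $\Xi=I_{n+1}-\frac1{n+1}\mathbf 1\mathbf 1^T$ is the orthogonal projection of $\mathbb R^{n+1}$ onto $H$ along $\mathbf 1$. *)

theory Defs
  imports "HOL-Analysis.Analysis"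
begin

text \<open>
  The space \<open>\<real>\<^sup>n\<^sup>+\<^sup>1\<close> is rendered as \<open>real ^ 'm\<close> with \<open>CARD('m) = n + 1\<close>.  The constant
  \<open>1 :: real ^ 'm\<close> is the library's all-ones vector (see \<open>one_vec_def\<close>).
\<close>

definition hyperplane_H :: "(real ^ 'm) set" where
  "hyperplane_H = {x. x \<bullet> 1 = 0}"

definition lattice_A :: "(real ^ 'm) set" where
  "lattice_A = {x. \<forall>i. x $ i \<in> \<int>} \<inter> hyperplane_H"

definition voronoi_cell_0 :: "(real ^ 'm) set" where
  "voronoi_cell_0 = {x \<in> hyperplane_H. \<forall>q \<in> lattice_A. norm x \<le> norm (x - q)}"

definition matrix_Xi :: "real ^ 'm ^ 'm" where
  "matrix_Xi = mat 1 - (1 / real CARD('m)) *\<^sub>R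
     ((columnvector 1 :: real ^ 1 ^ 'm) ** (rowvector 1 :: real ^ 'm ^ 1))"

text \<open>Entrywise form, and the fact that the matrix is the orthogonal projection onto the
  hyperplane along the all-ones vector.\<close>

lemma one_vec_nth: "(1 :: real ^ 'm) $ i = 1"
  by simp

lemma matrix_Xi_nth:
  "(matrix_Xi :: real ^ 'm ^ 'm) $ i $ j = (if i = j then 1 else 0) - 1 / real CARD('m)"
  by (simp add: matrix_Xi_def mat_def matrix_matrix_mult_def columnvector_def rowvector_def)

lemma matrix_Xi_mult:
  "matrix_Xi *v x = x - ((x \<bullet> 1) / real CARD('m)) *\<^sub>R (1 :: real ^ 'm)"
  by (simp add: vec_eq_iff matrix_vector_mult_def matrix_Xi_nth inner_vec_def
      left_diff_distrib sum_subtractf if_distrib [of "\<lambda>y. y * _"] sum_divide_distrib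
      cong: if_cong)

lemma matrix_Xi_in_hyperplane: "matrix_Xi *v x \<in> hyperplane_H"
  by (simp add: hyperplane_H_def matrix_Xi_mult inner_diff_left) (simp add: inner_vec_def)

lemma matrix_Xi_fixes_hyperplane: "x \<in> hyperplane_H \<Longrightarrow> matrix_Xi *v x = x"
  by (simp add: hyperplane_H_def matrix_Xi_mult)

lemma matrix_Xi_one: "matrix_Xi *v (1 :: real ^ 'm) = 0"
  by (simp add: matrix_Xi_mult inner_vec_def)

end

theory Submission
  imports Defs
begin

text \<open>
  The Voronoi inequality for a lattice vector \<open>q\<close> reads \<open>2 (x \<bullet> q) \<le> q \<bullet> q\<close>. The
  differences of two standard basis vectors show that the coordinates of a point of the cell
  differ by at most 1, so that subtracting a multiple of the all-ones vector, which the
  projection kills, moves the point into the cube. Conversely, the projection of a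
  point \<open>y\<close> of the cube has the same inner product with \<open>q\<close> as \<open>y\<close> itself, and
  \<open>2 y\<^sub>i q\<^sub>i \<le> q\<^sub>i\<^sup>2 + q\<^sub>i\<close> because \<open>q\<^sub>i\<close> is an integer; the linear terms sum to 0.
\<close>

lemma norm_le_norm_diff_iff:
  fixes x q :: "'a::real_inner"
  shows "norm x \<le> norm (x - q) \<longleftrightarrow> 2 * (x \<bullet> q) \<le> q \<bullet> q"
  by (simp add: norm_le inner_diff_left inner_diff_right inner_commute)

lemma axis_diff_in_lattice_A: "axis i 1 - axis j 1 \<in> lattice_A"
  by (simp add: lattice_A_def hyperplane_H_def inner_diff_left inner_axis') (simp add: axis_def)

lemma voronoi_cell_0_coordinate_diff_le:
  fixes x :: "real ^ 'm"
  assumes "x \<in> voronoi_cell_0"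
  shows "x $ i - x $ j \<le> 1"
proof (cases "i = j")
  case False
  let ?q = "axis i 1 - axis j 1 :: real ^ 'm"
  have "2 * (x \<bullet> ?q) \<le> ?q \<bullet> ?q"
    using assms axis_diff_in_lattice_A[of i j]
    unfolding voronoi_cell_0_def norm_le_norm_diff_iff by blast
  then show ?thesis
    \<comment> \<open>For \<open>i \<noteq> j\<close>, \<open>?q \<bullet> ?q = 2\<close>, so the
      factor 2 cancels.\<close>
    using False by (simp add: inner_diff_left inner_diff_right inner_axis)
      (simp add: axis_def)
qed simp

text \<open>The worst cases are \<open>y = 1\<close> for \<open>k > 0\<close> and
  \<open>y = 0\<close> for \<open>k < 0\<close>. They leave \<open>k * (k - 1) \<ge> 0\<close> and
  \<open>k * (k + 1) \<ge> 0\<close>, which hold for integers but can fail for other reals.\<close>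

lemma mult_le_half_square_plus_self:
  fixes y k :: real
  assumes "0 \<le> y" "y \<le> 1" "k \<in> \<int>"
  shows "2 * (y * k) \<le> k * k + k"
proof -
  consider "k \<ge> 1" | "k = 0" | "k \<le> -1"
    using assms(3) by (elim Ints_cases) force
  then show ?thesis
  proof cases
    case 1
    then have "y * k \<le> k" "k \<le> k * k"
      using assms by (auto simp: mult_left_le_one_le)
    then show ?thesis by linarith
  next
    case 3
    then have "y * k \<le> 0" "0 \<le> k * (k + 1)"
      using assms by (auto intro: mult_nonneg_nonpos mult_nonpos_nonpos)
    then show ?thesis by (simp add: distrib_left)
  qed simp
qed

text \<open>The projection changes \<open>y\<close> only by a multiple of the all-ones vector, which
  is orthogonal to \<open>q\<close>.\<close>

lemma matrix_Xi_mult_inner: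
  assumes "q \<in> hyperplane_H"
  shows "(matrix_Xi *v y) \<bullet> q = y \<bullet> q"
  using assms by (simp add: matrix_Xi_mult hyperplane_H_def inner_diff_left inner_commute[of 1])

lemma matrix_Xi_cube_in_voronoi_cell_0:
  fixes y :: "real ^ 'm"
  assumes "y \<in> cbox 0 1"
  shows "matrix_Xi *v y \<in> voronoi_cell_0"
proof -
  have "2 * ((matrix_Xi *v y) \<bullet> q) \<le> q \<bullet> q" if "q \<in> lattice_A" for q
  proof -
    have q: "q \<in> hyperplane_H" "\<And>i. q $ i \<in> \<int>"
      using that by (auto simp: lattice_A_def)
    have "2 * (y \<bullet> q) = (\<Sum>i\<in>UNIV. 2 * (y $ i * q $ i))"
      by (simp add: inner_vec_def sum_distrib_left)
    also have "\<dots> \<le> (\<Sum>i\<in>UNIV. q $ i * q $ i + q $ i)"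
      using assms q(2) by (intro sum_mono mult_le_half_square_plus_self) (auto simp: mem_box_cart)
    also have "\<dots> = q \<bullet> q + q \<bullet> 1"
      by (simp add: sum.distrib inner_vec_def)
    also have "\<dots> = q \<bullet> q"
      using q(1) by (simp add: hyperplane_H_def)
    finally show ?thesis
      using q(1) by (simp add: matrix_Xi_mult_inner)
  qed
  then show ?thesis
    by (simp add: voronoi_cell_0_def norm_le_norm_diff_iff matrix_Xi_in_hyperplane)
qed

lemma voronoi_cell_0_subset_matrix_Xi_cube:
  "(voronoi_cell_0 :: (real ^ 'm) set) \<subseteq> (\<lambda>x. matrix_Xi *v x) ` cbox 0 1"
proof
  fix x :: "real ^ 'm"
  assume x: "x \<in> voronoi_cell_0"
  \<comment> \<open>Subtracting the least coordinate makes all entries nonnegative; as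
    \<open>m\<close> is attained at some \<open>j\<close>, the bound on coordinate differences keeps
    them at most 1.\<close>
  define m where "m = Min (range (($) x))"
  have "m \<in> range (($) x)"
    unfolding m_def by (intro Min_in) auto
  then obtain j where j: "m = x $ j" by auto
  let ?y = "x - m *\<^sub>R 1"
  have "m \<le> x $ i" for i
    unfolding m_def by (intro Min_le) auto
  moreover have "x $ i - m \<le> 1" for i
    using voronoi_cell_0_coordinate_diff_le[OF x] j by simp
  ultimately have "?y \<in> cbox 0 1"
    by (simp add: mem_box_cart)
  moreover have "matrix_Xi *v ?y = x"
    using x by (simp add: voronoi_cell_0_def matrix_vector_mult_diff_distrib
        matrix_vector_mult_scaleR matrix_Xi_one matrix_Xi_fixes_hyperplane)
  ultimately show "x \<in> (\<lambda>x. matrix_Xi *v x) ` cbox 0 1"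
    by (metis imageI)
qed

theorem lemma10:
  fixes n :: nat
  assumes "n \<ge> 1"
    and "CARD('m::finite) = n + 1"
  shows "(voronoi_cell_0 :: (real ^ 'm) set) = (\<lambda>x. matrix_Xi *v x) ` cbox 0 1"
  using voronoi_cell_0_subset_matrix_Xi_cube matrix_Xi_cube_in_voronoi_cell_0 by blast

end
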